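(* Let $a,b$ be integers with $2\le a\le b$. Then $\widetilde{H}_i(\Delta(P(a,b));\mathbb{Z})=0$ for all $i>a-2$, and for $0\le i\le a-2$ $$\mathrm{rank}\ \widetilde{H}_i(\Delta(P(a,b));\mathbb{Z}) = 2\sum_{t=0}^{i}\binom{a-3-i}{t-1}\left[\binom{i}{t}\binom{b-2-i}{i-t}+\binom{i}{t-1}\binom{b-3-i}{i-t}\right],$$ where $\binom{-1}{-1}=1$.
   Context: Here $\mathbb{N}=\{0,1,2,\ldots\}$. For $(a_1,a_2),(b_1,b_2)\in\mathbb{N}^2$, say that $(a_1,a_2)$ properly divides $(b_1,b_2)$ if for each $i$ either $a_i=b_i=0$ or $a_i<b_i$. Write $(a_1,a_2)\le(b_1,b_2)$ if the two are equal or the first properly divides the second; this is a partial order. $P(a,b)$ is the set of all $(c,d)\in\mathbb{N}^2$ with $(c,d)\le(a,b)$, ordered by $\le$; it has unique minimal element $\widehat 0=(0,0)$ and unique maximal element $\widehat 1=(a,b)$. The order complex $\Delta(P(a,b))$ is the simplicial complex of all chains in $P(a,b)\setminus\{\widehat 0,\widehat 1\}$. $\widetilde H_i$ denotes reduced simplicial homology. Binomial convention: for integers $n,k$, $\binom{n}{k}$ is the usual binomial coefficient if $0\le k\le n$, $\binom{-1}{-1}=1$, and $\binom{n}{k}=0$ in all other cases (in particular $\binom{-1}{k}=0$ for $k\ge 0$). *)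

theory Defs
  imports
    "HOL-Algebra.Free_Abelian_Groups"
    "HOL-Library.Extended_Nat"
begin

section \<open>Proper divisibility and the poset P(a,b)\<close>

definition prop_div :: "nat \<times> nat \<Rightarrow> nat \<times> nat \<Rightarrow> bool" where
  "prop_div x y \<longleftrightarrow>
     (fst x = 0 \<and> fst y = 0 \<or> fst x < fst y) \<and>
     (snd x = 0 \<and> snd y = 0 \<or> snd x < snd y)"

definition pd_le :: "nat \<times> nat \<Rightarrow> nat \<times> nat \<Rightarrow> bool" where
  "pd_le x y \<longleftrightarrow> x = y \<or> prop_div x y"

text \<open>\<open>prop_div\<close> itself is not irreflexive, since the origin properly divides itself.\<close>

definition pd_less :: "nat \<times> nat \<Rightarrow> nat \<times> nat \<Rightarrow> bool" where
  "pd_less x y \<longleftrightarrow> pd_le x y \<and> x \<noteq> y"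

definition P_poset :: "nat \<Rightarrow> nat \<Rightarrow> (nat \<times> nat) set" where
  "P_poset a b = {x. pd_le x (a, b)}"


section \<open>Order complexes\<close>

text \<open>Simplicial complexes are sets of finite sets and include the empty face.\<close>

definition order_complex :: "('a \<Rightarrow> 'a \<Rightarrow> bool) \<Rightarrow> 'a set \<Rightarrow> 'a set set" where
  "order_complex R X = {\<sigma>. \<sigma> \<subseteq> X \<and> finite \<sigma> \<and> Complete_Partial_Order.chain R \<sigma>}"

definition Delta_P :: "nat \<Rightarrow> nat \<Rightarrow> (nat \<times> nat) set set" where
  "Delta_P a b = order_complex pd_le (P_poset a b - {(0, 0), (a, b)})"


section \<open>Reduced simplicial homology with integer coefficients\<close>

text \<open>
  The argument \<open>lt\<close> is a strict order on the vertices that is total on every simplex of \<open>K\<close>; it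
  orients each simplex by listing its vertices increasingly. For an order complex it is the strict
  order of the poset. The homology groups do not depend on this choice up to isomorphism.
\<close>

definition simplices :: "'a set set \<Rightarrow> int \<Rightarrow> 'a set set" where
  "simplices K i = {\<sigma> \<in> K. finite \<sigma> \<and> int (card \<sigma>) = i + 1}"

definition simplicial_chain_group :: "'a set set \<Rightarrow> int \<Rightarrow> ('a set \<Rightarrow>\<^sub>0 int) monoid" where
  "simplicial_chain_group K i = free_Abelian_group (simplices K i)"

text \<open>
  If \<open>x\<close> is the vertex \<open>x\<^sub>k\<close> of \<open>x\<^sub>0 < \<dots> < x\<^sub>i\<close>, the exponent of the sign is \<open>k\<close>, so the
  boundary of a simplex is the usual alternating sum of its facets. The boundary of a vertex is the
  empty face (the augmentation), and that of the empty face is zero.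
\<close>

definition simplicial_boundary ::
  "('a \<Rightarrow> 'a \<Rightarrow> bool) \<Rightarrow> ('a set \<Rightarrow>\<^sub>0 int) \<Rightarrow> ('a set \<Rightarrow>\<^sub>0 int)" where
  "simplicial_boundary lt =
     frag_extend (\<lambda>\<sigma>. \<Sum>x\<in>\<sigma>. frag_cmul ((-1) ^ card {y \<in> \<sigma>. lt y x}) (frag_of (\<sigma> - {x})))"

definition simplicial_cycles ::
  "('a \<Rightarrow> 'a \<Rightarrow> bool) \<Rightarrow> 'a set set \<Rightarrow> int \<Rightarrow> ('a set \<Rightarrow>\<^sub>0 int) set" where
  "simplicial_cycles lt K i =
     {c \<in> carrier (simplicial_chain_group K i). simplicial_boundary lt c = 0}"

definition simplicial_boundaries ::
  "('a \<Rightarrow> 'a \<Rightarrow> bool) \<Rightarrow> 'a set set \<Rightarrow> int \<Rightarrow> ('a set \<Rightarrow>\<^sub>0 int) set" where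
  "simplicial_boundaries lt K i =
     simplicial_boundary lt ` carrier (simplicial_chain_group K (i + 1))"

definition reduced_simplicial_homology ::
  "('a \<Rightarrow> 'a \<Rightarrow> bool) \<Rightarrow> 'a set set \<Rightarrow> int \<Rightarrow> ('a set \<Rightarrow>\<^sub>0 int) set monoid" where
  "reduced_simplicial_homology lt K i =
     subgroup_generated (simplicial_chain_group K i) (simplicial_cycles lt K i)
       Mod simplicial_boundaries lt K i"


section \<open>Rank of an abelian group\<close>

definition Z_independent :: "('a, 'm) monoid_scheme \<Rightarrow> 'a set \<Rightarrow> bool" where
  "Z_independent G S \<longleftrightarrow> S \<subseteq> carrier G \<and> finite S \<and>
     (\<forall>c :: 'a \<Rightarrow> int. finprod G (\<lambda>x. x [^]\<^bsub>G\<^esub> c x) S = \<one>\<^bsub>G\<^esub> \<longrightarrow> (\<forall>x\<in>S. c x = 0))"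

definition abelian_rank :: "('a, 'm) monoid_scheme \<Rightarrow> enat" where
  "abelian_rank G = (SUP S \<in> {S. Z_independent G S}. enat (card S))"


section \<open>Binomial coefficients of integers\<close>

definition int_binom :: "int \<Rightarrow> int \<Rightarrow> nat" where
  "int_binom n k =
     (if 0 \<le> k \<and> k \<le> n then nat n choose nat k
      else if n = -1 \<and> k = -1 then 1
      else 0)"

end

theory Submission
  imports Defs
begin

text \<open>
  Let \<open>Q\<close> be the proper part of \<open>P(a,b)\<close>, that is \<open>{0..<a} \<times> {0..<b}\<close> without the origin.  The proof
  computes the homology of \<open>\<Delta>(Q)\<close> by building \<open>Q\<close> up one point at a time.  Adding a point \<open>x\<close> to a
  poset \<open>X\<close> glues a cone along the link of \<open>x\<close>, the order complex of the points of \<open>X\<close> comparable to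
  \<open>x\<close>.  If some \<open>v\<close> in \<open>X\<close> is comparable to all those points, then the link is also coned off inside
  \<open>X\<close>, so its cycles get suspended between \<open>x\<close> and \<open>v\<close>, and
  \[ H_i(X \cup \{x\}) = H_i(X) \oplus H_{i-1}(\mathrm{link}\ x). \]
  This is \<open>free_homology_insert\<close>.  When \<open>v\<close> itself lies in the link, the link is a cone and contributes
  nothing: \<open>x\<close> is a beat point.

  The points \<open>(c,0)\<close> and \<open>(c,1)\<close> with \<open>c \<ge> 2\<close> are beat points because of \<open>(1,0)\<close>, and \<open>(0,d)\<close> and \<open>(1,d)\<close>
  with \<open>d \<ge> 2\<close> because of \<open>(0,1)\<close>.  What is left after deleting them is the box
  \<open>{2..<a} \<times> {2..<b}\<close> together with the three pairwise incomparable points \<open>(1,0)\<close>, \<open>(0,1)\<close>, \<open>(1,1)\<close>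
  below all of it.  Hence \<open>H_i(\<Delta>(Q))\<close> is the sum of two copies of \<open>H_(i-1)\<close> of the box; this is the
  factor 2 of the theorem.

  On a box both coordinates have to increase strictly along a chain.  Its smallest corner \<open>(p,q)\<close> lies
  below the box \<open>{p<..<a} \<times> {q<..<b}\<close>, and each further point on the two edges through the corner has as
  its link a smaller box, which is coned off by the corner.  So the homology of a box is a direct sum
  of shifted homologies of smaller boxes.  Unfolding this recursion down to empty boxes, whose only
  homology is a copy of the integers in degree \<open>-1\<close>, shows that homology is free and that its rank
  counts paths of a rook that moves towards the axes, one move per passage to a link.  Each passage
  shortens both sides of the box, so there are at most \<open>a - 2\<close> of them.  Counting these paths by the number \<open>t\<close> of
  moves in the first direction gives the binomial sum.
\<close>

section \<open>Integer combinations of generators\<close>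

lemma frag_cmul_diff: "frag_cmul k (a - b) = frag_cmul k a - frag_cmul k b"
  by (rule poly_mapping_eqI) (simp add: lookup_minus algebra_simps)

lemma keys_lincomb:
  assumes "\<And>k. k < n \<Longrightarrow> Poly_Mapping.keys (z k) \<subseteq> S"
  shows "Poly_Mapping.keys (\<Sum>k<n::nat. frag_cmul (c k) (z k)) \<subseteq> S"
  by (rule order_trans [OF keys_sum]) (use assms in auto)

lemma keys_plus: "Poly_Mapping.keys a \<subseteq> S \<Longrightarrow> Poly_Mapping.keys b \<subseteq> S \<Longrightarrow> Poly_Mapping.keys (a + b) \<subseteq> S"
  using keys_add [of a b] by blast

lemma keys_minus_subset: "Poly_Mapping.keys a \<subseteq> S \<Longrightarrow> Poly_Mapping.keys b \<subseteq> S \<Longrightarrow> Poly_Mapping.keys (a - b) \<subseteq> S"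
  using keys_diff [of a b] by blast

lemma sum_lessThan_add:
  "(\<Sum>k<p + q. f k) = (\<Sum>k<p. f k) + (\<Sum>k<q::nat. f (p + k))" for f :: "nat \<Rightarrow> 'b::comm_monoid_add"
  by (induction q) (simp_all add: add.assoc)

section \<open>Chains of an order complex and their boundaries\<close>

text \<open>
  The faces of the order complex are the finite sets of pairwise comparable points, so the arguments
  below are phrased in terms of comparability.
\<close>

locale refl_antisym =
  fixes le :: "'a \<Rightarrow> 'a \<Rightarrow> bool"
  assumes refl: "le x x"
    and antisym: "le x y \<Longrightarrow> le y x \<Longrightarrow> x = y"
begin

definition lt :: "'a \<Rightarrow> 'a \<Rightarrow> bool" where
  "lt x y \<longleftrightarrow> le x y \<and> x \<noteq> y"

definition comparable :: "'a \<Rightarrow> 'a \<Rightarrow> bool" where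
  "comparable x y \<longleftrightarrow> le x y \<or> le y x"

definition link :: "'a set \<Rightarrow> 'a \<Rightarrow> 'a set" where
  "link X x = {y \<in> X. y \<noteq> x \<and> comparable x y}"

abbreviation faces :: "'a set \<Rightarrow> int \<Rightarrow> 'a set set" where
  "faces X i \<equiv> simplices (order_complex le X) i"

abbreviation bd :: "('a set \<Rightarrow>\<^sub>0 int) \<Rightarrow> ('a set \<Rightarrow>\<^sub>0 int)" where
  "bd \<equiv> simplicial_boundary lt"

definition cycles :: "'a set \<Rightarrow> int \<Rightarrow> ('a set \<Rightarrow>\<^sub>0 int) set" where
  "cycles X i = {c. Poly_Mapping.keys c \<subseteq> faces X i \<and> bd c = 0}"

definition boundaries :: "'a set \<Rightarrow> int \<Rightarrow> ('a set \<Rightarrow>\<^sub>0 int) set" where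
  "boundaries X i = bd ` {c. Poly_Mapping.keys c \<subseteq> faces X (i + 1)}"

text \<open>The sign with which the boundary deletes \<open>v\<close> from a face, or the cone inserts it.\<close>

definition pos_sign :: "'a \<Rightarrow> 'a set \<Rightarrow> int" where
  "pos_sign v \<sigma> = (-1) ^ card {y \<in> \<sigma>. lt y v}"

text \<open>
  Faces that contain \<open>v\<close> are sent to zero.  With this convention \<open>cone_homotopy\<close> holds for them as
  well, so that \<open>v\<close> may be a vertex of the complex to which the cone operator is applied.
\<close>

definition cone :: "'a \<Rightarrow> ('a set \<Rightarrow>\<^sub>0 int) \<Rightarrow> ('a set \<Rightarrow>\<^sub>0 int)" where
  "cone v = frag_extend (\<lambda>\<sigma>. if v \<in> \<sigma> then 0 else frag_cmul (pos_sign v \<sigma>) (frag_of (insert v \<sigma>)))"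

lemma faces_iff:
  "\<sigma> \<in> faces X i \<longleftrightarrow> \<sigma> \<subseteq> X \<and> finite \<sigma> \<and> (\<forall>x\<in>\<sigma>. \<forall>y\<in>\<sigma>. comparable x y) \<and> int (card \<sigma>) = i + 1"
  by (auto simp: simplices_def order_complex_def Complete_Partial_Order.chain_def comparable_def)

lemma comparable_refl: "comparable x x"
  by (simp add: comparable_def refl)

lemma comparable_sym: "comparable x y \<longleftrightarrow> comparable y x"
  by (auto simp: comparable_def)

lemma bd_linear:
  "bd 0 = 0" "bd (x + y) = bd x + bd y" "bd (x - y) = bd x - bd y" "bd (- x) = - bd x"
  "bd (frag_cmul k x) = frag_cmul k (bd x)"
  by (simp_all add: simplicial_boundary_def frag_extend_add frag_extend_diff frag_extend_cmul frag_extend_minus)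

lemma cone_linear:
  "cone v 0 = 0" "cone v (x + y) = cone v x + cone v y" "cone v (x - y) = cone v x - cone v y"
  "cone v (- x) = - cone v x" "cone v (frag_cmul k x) = frag_cmul k (cone v x)"
  by (simp_all add: cone_def frag_extend_add frag_extend_diff frag_extend_cmul frag_extend_minus)

lemma bd_sum: "bd (\<Sum>j\<in>J. f j) = (\<Sum>j\<in>J. bd (f j))"
  by (induction J rule: infinite_finite_induct) (simp_all add: bd_linear)

lemma cone_sum: "cone v (\<Sum>j\<in>J. f j) = (\<Sum>j\<in>J. cone v (f j))"
  by (induction J rule: infinite_finite_induct) (simp_all add: cone_linear)

lemma bd_frag_of:
  "bd (frag_of \<sigma>) = (\<Sum>x\<in>\<sigma>. frag_cmul (pos_sign x \<sigma>) (frag_of (\<sigma> - {x})))"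
  by (simp add: simplicial_boundary_def pos_sign_def)

lemma cone_frag_of:
  "cone v (frag_of \<sigma>) = (if v \<in> \<sigma> then 0 else frag_cmul (pos_sign v \<sigma>) (frag_of (insert v \<sigma>)))"
  by (simp add: cone_def)

lemma pos_sign_square [simp]: "pos_sign v \<sigma> * pos_sign v \<sigma> = 1"
  by (simp add: pos_sign_def flip: power_add mult_2)

lemma pos_sign_insert_self [simp]: "pos_sign v (insert v \<sigma>) = pos_sign v \<sigma>"
  unfolding pos_sign_def by (rule arg_cong [where f = "\<lambda>S. (-1) ^ card S"]) (auto simp: lt_def)

lemma pos_sign_remove_self [simp]: "pos_sign v (\<sigma> - {v}) = pos_sign v \<sigma>"
  unfolding pos_sign_def by (rule arg_cong [where f = "\<lambda>S. (-1) ^ card S"]) (auto simp: lt_def)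

text \<open>
  Inserting \<open>v\<close> and deleting \<open>x\<close> anticommute: exactly one of the two points lies above the other, and
  its position in the face changes by one according to whether the other is present.
\<close>

lemma pos_sign_exchange:
  assumes "finite \<sigma>" "x \<in> \<sigma>" "v \<notin> \<sigma>" "comparable x v"
  shows "pos_sign v \<sigma> * pos_sign x (insert v \<sigma>) = - (pos_sign x \<sigma> * pos_sign v (\<sigma> - {x}))"
proof -
  have xv: "x \<noteq> v" using assms by auto
  show ?thesis
  proof (cases "lt x v")
    case True
    then have not: "\<not> lt v x" using antisym by (auto simp: lt_def)
    have "{y \<in> \<sigma>. lt y v} = insert x {y \<in> \<sigma> - {x}. lt y v}" using True assms by auto
    then have "card {y \<in> \<sigma>. lt y v} = Suc (card {y \<in> \<sigma> - {x}. lt y v})"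
      using assms by simp
    moreover have "{y \<in> insert v \<sigma>. lt y x} = {y \<in> \<sigma>. lt y x}" using not by auto
    ultimately show ?thesis by (simp add: pos_sign_def)
  next
    case False
    then have vx: "lt v x" using assms xv by (auto simp: lt_def comparable_def)
    have "{y \<in> insert v \<sigma>. lt y x} = insert v {y \<in> \<sigma>. lt y x}" using vx by auto
    then have "card {y \<in> insert v \<sigma>. lt y x} = Suc (card {y \<in> \<sigma>. lt y x})"
      using assms by simp
    moreover have "{y \<in> \<sigma> - {x}. lt y v} = {y \<in> \<sigma>. lt y v}" using False by auto
    ultimately show ?thesis by (simp add: pos_sign_def)
  qed
qed

text \<open>
  By the exchange rule all terms cancel except the one in which \<open>v\<close> is first inserted and then deleted
  again (or, for a face containing \<open>v\<close>, first deleted and then inserted).  So the cone operator is a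
  contraction of the chain complex.
\<close>

lemma cone_homotopy_simplex:
  assumes fin: "finite \<sigma>" and comp: "\<And>x. x \<in> \<sigma> \<Longrightarrow> comparable x v"
  shows "bd (cone v (frag_of \<sigma>)) + cone v (bd (frag_of \<sigma>)) = frag_of \<sigma>"
proof (cases "v \<in> \<sigma>")
  case False
  have 1: "bd (cone v (frag_of \<sigma>)) = frag_of \<sigma> +
      (\<Sum>x\<in>\<sigma>. frag_cmul (pos_sign v \<sigma> * pos_sign x (insert v \<sigma>)) (frag_of (insert v (\<sigma> - {x}))))"
  proof -
    have "insert v \<sigma> - {x} = insert v (\<sigma> - {x})" if "x \<in> \<sigma>" for x
      using that False by auto
    then show ?thesis using False fin
      by (simp add: cone_frag_of bd_linear bd_frag_of frag_cmul_distrib2 frag_cmul_sum)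
  qed
  have 2: "cone v (bd (frag_of \<sigma>)) =
      (\<Sum>x\<in>\<sigma>. frag_cmul (pos_sign x \<sigma> * pos_sign v (\<sigma> - {x})) (frag_of (insert v (\<sigma> - {x}))))"
    using False by (simp add: bd_frag_of cone_sum cone_linear cone_frag_of)
  have "(\<Sum>x\<in>\<sigma>. frag_cmul (pos_sign v \<sigma> * pos_sign x (insert v \<sigma>)) (frag_of (insert v (\<sigma> - {x}))))
     = - cone v (bd (frag_of \<sigma>))"
    unfolding 2 sum_negf [symmetric]
    by (rule sum.cong) (simp_all add: pos_sign_exchange False fin comp)
  then show ?thesis by (simp add: 1)
next
  case True
  have "cone v (bd (frag_of \<sigma>)) =
      (\<Sum>x\<in>\<sigma>. if x = v then frag_of \<sigma> else 0)"
    unfolding bd_frag_of cone_sum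
    by (rule sum.cong) (use True in \<open>auto simp: cone_linear cone_frag_of insert_absorb\<close>)
  then show ?thesis using True fin by (simp add: cone_frag_of bd_linear)
qed

lemma cone_homotopy:
  assumes "Poly_Mapping.keys c \<subseteq> {\<sigma>. finite \<sigma> \<and> (\<forall>x\<in>\<sigma>. comparable x v)}"
  shows "bd (cone v c) + cone v (bd c) = c"
  using assms
proof (induction c rule: frag_induction)
  case (diff a b)
  have "bd (cone v (a - b)) + cone v (bd (a - b)) =
      (bd (cone v a) + cone v (bd a)) - (bd (cone v b) + cone v (bd b))"
    by (simp add: bd_linear cone_linear)
  with diff show ?case by simp
qed (auto simp: cone_homotopy_simplex bd_linear cone_linear)

text \<open>
  A face is up to sign a cone over a smaller face, and \<open>cone_homotopy\<close>, used in two consecutive degrees,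
  gives \<open>\<partial>\<partial>(cone c) = cone (\<partial>\<partial>c)\<close>.  The usual double sum is thereby avoided.
\<close>

lemma bd_bd_simplex:
  assumes "finite \<sigma>" "\<And>x y. x \<in> \<sigma> \<Longrightarrow> y \<in> \<sigma> \<Longrightarrow> comparable x y"
  shows "bd (bd (frag_of \<sigma>)) = 0"
  using assms
proof (induction \<sigma> rule: finite_induct)
  case empty
  then show ?case by (simp add: bd_frag_of bd_linear)
next
  case (insert v \<sigma>)
  have c: "comparable x v" if "x \<in> \<sigma>" for x using insert.prems that by auto
  have keys: "Poly_Mapping.keys (bd (frag_of \<sigma>)) \<subseteq> {\<sigma>. finite \<sigma> \<and> (\<forall>x\<in>\<sigma>. comparable x v)}"
    unfolding bd_frag_of
    by (rule order_trans [OF keys_sum]) (use c insert.hyps in \<open>auto split: if_splits\<close>)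
  have "frag_of (insert v \<sigma>) = frag_cmul (pos_sign v \<sigma>) (cone v (frag_of \<sigma>))"
    using insert.hyps by (simp add: cone_frag_of)
  moreover have "bd (cone v (frag_of \<sigma>)) = frag_of \<sigma> - cone v (bd (frag_of \<sigma>))"
    using cone_homotopy_simplex [of \<sigma> v] c insert.hyps by (simp add: eq_diff_eq)
  moreover have "bd (cone v (bd (frag_of \<sigma>))) = bd (frag_of \<sigma>)"
    using cone_homotopy [OF keys] insert by (simp add: cone_linear)
  ultimately show ?case by (simp add: bd_linear)
qed

lemma bd_bd:
  assumes "Poly_Mapping.keys c \<subseteq> faces X i"
  shows "bd (bd c) = 0"
  using assms
  by (induction c rule: frag_induction) (auto simp: bd_bd_simplex bd_linear faces_iff)

lemma keys_bd:
  assumes "Poly_Mapping.keys c \<subseteq> faces X i"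
  shows "Poly_Mapping.keys (bd c) \<subseteq> faces X (i - 1)"
  using assms
proof (induction c rule: frag_induction)
  case (diff a b)
  then show ?case using keys_diff [of "bd a" "bd b"] by (auto simp: bd_linear)
next
  case (one \<sigma>)
  have "\<sigma> - {x} \<in> faces X (i - 1)" if "x \<in> \<sigma>" for x
  proof -
    have "card \<sigma> > 0" using one that by (auto simp: faces_iff card_gt_0_iff)
    then show ?thesis using one that by (auto simp: faces_iff card_Diff_singleton of_nat_diff)
  qed
  then show ?case unfolding bd_frag_of
    by (intro order_trans [OF keys_sum]) (auto split: if_splits)
qed (simp add: bd_linear)

lemma faces_mono: "X \<subseteq> Y \<Longrightarrow> faces X i \<subseteq> faces Y i"
  by (rule subsetI) (simp add: faces_iff subset_iff)

lemma keys_cone: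
  assumes "Poly_Mapping.keys c \<subseteq> faces L i" "\<And>y. y \<in> L \<Longrightarrow> comparable y v"
    and "L \<subseteq> X" "v \<in> X"
  shows "Poly_Mapping.keys (cone v c) \<subseteq> faces X (i + 1)"
  using assms(1)
proof (induction c rule: frag_induction)
  case (one \<sigma>)
  have "insert v \<sigma> \<in> faces X (i + 1)" if "v \<notin> \<sigma>"
    using one that assms(2-) by (auto simp: faces_iff comparable_refl comparable_sym [of v])
  then show ?case by (auto simp: cone_frag_of)
next
  case (diff a b)
  then show ?case using keys_diff [of "cone v a" "cone v b"] by (auto simp: cone_linear)
qed (simp add: cone_linear)

lemma cone_homotopy_faces:
  assumes "Poly_Mapping.keys c \<subseteq> faces L i" "\<And>y. y \<in> L \<Longrightarrow> comparable y v"
  shows "bd (cone v c) = c - cone v (bd c)"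
proof -
  have "Poly_Mapping.keys c \<subseteq> {\<sigma>. finite \<sigma> \<and> (\<forall>x\<in>\<sigma>. comparable x v)}"
    using assms by (fastforce simp: faces_iff)
  from cone_homotopy [OF this] show ?thesis by (simp add: eq_diff_eq)
qed

section \<open>Adding a point\<close>

text \<open>
  The faces through \<open>x\<close> are exactly the cones with apex \<open>x\<close> over the faces of the link.
\<close>

lemma chain_split_vertex:
  assumes "Poly_Mapping.keys c \<subseteq> faces (insert x X) i" "x \<notin> X"
  obtains \<alpha> \<beta> where "Poly_Mapping.keys \<alpha> \<subseteq> faces (link X x) (i - 1)"
    "Poly_Mapping.keys \<beta> \<subseteq> faces X i" "c = cone x \<alpha> + \<beta>"
proof -
  let ?P = "\<lambda>c. \<exists>\<alpha> \<beta>. Poly_Mapping.keys \<alpha> \<subseteq> faces (link X x) (i - 1) \<and>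
    Poly_Mapping.keys \<beta> \<subseteq> faces X i \<and> c = cone x \<alpha> + \<beta>"
  have "?P c"
    using assms(1)
  proof (induction c rule: frag_induction)
    case zero
    show ?case by (intro exI [of _ 0]) (simp add: cone_linear)
  next
    case (one \<sigma>)
    show ?case
    proof (cases "x \<in> \<sigma>")
      case True
      let ?\<alpha> = "frag_cmul (pos_sign x \<sigma>) (frag_of (\<sigma> - {x}))"
      have "card \<sigma> > 0" using one True by (auto simp: faces_iff card_gt_0_iff)
      then have "\<sigma> - {x} \<in> faces (link X x) (i - 1)"
        using one True by (auto simp: faces_iff link_def card_Diff_singleton of_nat_diff)
      then have "Poly_Mapping.keys ?\<alpha> \<subseteq> faces (link X x) (i - 1)" by auto
      moreover have "frag_of \<sigma> = cone x ?\<alpha> + 0"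
        using True by (simp add: cone_linear cone_frag_of insert_absorb)
      ultimately show ?thesis by (metis empty_subsetI keys_zero)
    next
      case False
      then have "Poly_Mapping.keys (frag_of \<sigma>) \<subseteq> faces X i"
        using one by (auto simp: faces_iff)
      then show ?thesis by (intro exI [of _ 0] exI [of _ "frag_of \<sigma>"]) (simp add: cone_linear)
    qed
  next
    case (diff c d)
    then obtain \<alpha> \<beta> \<alpha>' \<beta>' where
      "Poly_Mapping.keys \<alpha> \<subseteq> faces (link X x) (i - 1)" "Poly_Mapping.keys \<beta> \<subseteq> faces X i"
      "Poly_Mapping.keys \<alpha>' \<subseteq> faces (link X x) (i - 1)" "Poly_Mapping.keys \<beta>' \<subseteq> faces X i"
      and "c = cone x \<alpha> + \<beta>" "d = cone x \<alpha>' + \<beta>'" by blast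
    then show ?case
      using keys_diff [of \<alpha> \<alpha>'] keys_diff [of \<beta> \<beta>']
      by (intro exI [of _ "\<alpha> - \<alpha>'"] exI [of _ "\<beta> - \<beta>'"]) (auto simp: cone_linear)
  qed
  then show ?thesis using that by blast
qed

lemma cone_eq_zeroD:
  assumes "cone x \<alpha> + \<beta> = 0"
    and \<alpha>: "Poly_Mapping.keys \<alpha> \<subseteq> {\<sigma>. x \<notin> \<sigma>}" and \<beta>: "Poly_Mapping.keys \<beta> \<subseteq> {\<sigma>. x \<notin> \<sigma>}"
  shows "\<alpha> = 0" and "\<beta> = 0"
proof -
  \<comment> \<open>a left inverse of the cone operator that vanishes on the faces avoiding \<open>x\<close>\<close>
  define u where "u = frag_extend (\<lambda>\<sigma>. if x \<in> \<sigma> then frag_cmul (pos_sign x \<sigma>) (frag_of (\<sigma> - {x})) else 0)"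
  have "u (cone x \<alpha>) = \<alpha>"
    using \<alpha>
  proof (induction \<alpha> rule: frag_induction)
    case (diff a b)
    then show ?case by (simp add: u_def cone_linear frag_extend_diff)
  qed (auto simp: u_def cone_linear cone_frag_of frag_extend_cmul)
  moreover have "u \<beta> = 0" unfolding u_def using \<beta> by (intro frag_extend_eq_0) auto
  ultimately have "u (cone x \<alpha> + \<beta>) = \<alpha>" by (simp add: u_def frag_extend_add)
  then show "\<alpha> = 0" using assms(1) by (simp add: u_def)
  then show "\<beta> = 0" using assms(1) by (simp add: cone_linear)
qed

text \<open>
  Reduced homology in degree \<open>i\<close> is free abelian of rank \<open>n\<close>, expressed on representatives: the classes
  of the cycles \<open>z 0, \<dots>, z (n - 1)\<close> form a basis.  Working with representatives keeps the gluing
  arguments on the level of chains.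
\<close>

definition free_homology :: "'a set \<Rightarrow> int \<Rightarrow> nat \<Rightarrow> bool" where
  "free_homology X i n \<longleftrightarrow> (\<exists>z :: nat \<Rightarrow> 'a set \<Rightarrow>\<^sub>0 int.
     (\<forall>k<n. z k \<in> cycles X i) \<and>
     (\<forall>y\<in>cycles X i. \<exists>c. y - (\<Sum>k<n. frag_cmul (c k) (z k)) \<in> boundaries X i) \<and>
     (\<forall>c. (\<Sum>k<n. frag_cmul (c k) (z k)) \<in> boundaries X i \<longrightarrow> (\<forall>k<n. c k = 0)))"

text \<open>
  The basis of the enlarged space consists of the old one and, for each basis cycle \<open>w\<close> of the link, the
  suspension \<open>cone x w - cone v w\<close>.  In general the inclusion of the link into \<open>X\<close> enters through a
  long exact sequence; the point \<open>v\<close> provides a cone that kills it, which splits that sequence.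
\<close>

lemma free_homology_insert:
  assumes xX: "x \<notin> X" and v: "v \<in> X" "\<And>y. y \<in> link X x \<Longrightarrow> comparable y v"
    and "free_homology X i p" and "free_homology (link X x) (i - 1) q"
  shows "free_homology (insert x X) i (p + q)"
proof -
  define L where "L = link X x"
  have LX: "L \<subseteq> X" by (auto simp: L_def link_def)
  have compx: "comparable y x" if "y \<in> L" for y
    using that by (auto simp: L_def link_def comparable_sym)
  have compv: "comparable y v" if "y \<in> L" for y using that v by (simp add: L_def)
  obtain z where z: "\<And>k. k < p \<Longrightarrow> z k \<in> cycles X i"
    and z_span: "\<And>y. y \<in> cycles X i \<Longrightarrow> \<exists>c. y - (\<Sum>k<p. frag_cmul (c k) (z k)) \<in> boundaries X i"
    and z_indep: "\<And>c. (\<Sum>k<p. frag_cmul (c k) (z k)) \<in> boundaries X i \<Longrightarrow> \<forall>k<p. c k = 0"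
    using assms(4) unfolding free_homology_def by blast
  obtain w where w: "\<And>k. k < q \<Longrightarrow> w k \<in> cycles L (i - 1)"
    and w_span: "\<And>y. y \<in> cycles L (i - 1) \<Longrightarrow>
        \<exists>c. y - (\<Sum>k<q. frag_cmul (c k) (w k)) \<in> boundaries L (i - 1)"
    and w_indep: "\<And>c. (\<Sum>k<q. frag_cmul (c k) (w k)) \<in> boundaries L (i - 1) \<Longrightarrow> \<forall>k<q. c k = 0"
    using assms(5) unfolding free_homology_def L_def by blast
  have wk: "Poly_Mapping.keys (w k) \<subseteq> faces L (i - 1)" "bd (w k) = 0" if "k < q" for k
    using w [OF that] by (auto simp: cycles_def)
  define s where "s k = (if k < p then z k else cone x (w (k - p)) - cone v (w (k - p)))" for k
  have s_lincomb: "(\<Sum>k<p + q. frag_cmul (c k) (s k)) =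
      (\<Sum>k<p. frag_cmul (c k) (z k)) +
      (cone x (\<Sum>k<q. frag_cmul (c (p + k)) (w k)) - cone v (\<Sum>k<q. frag_cmul (c (p + k)) (w k)))" for c
  proof -
    show ?thesis
      by (simp add: sum_lessThan_add s_def cone_sum cone_linear frag_cmul_diff sum_subtractf)
  qed
  have lcw: "Poly_Mapping.keys (\<Sum>k<q. frag_cmul (c k) (w k)) \<subseteq> faces L (i - 1)"
      "bd (\<Sum>k<q. frag_cmul (c k) (w k)) = 0" for c
    using wk by (auto intro!: keys_lincomb simp: bd_sum bd_linear)
  have lcz: "Poly_Mapping.keys (\<Sum>k<p. frag_cmul (c k) (z k)) \<subseteq> faces X i"
      "bd (\<Sum>k<p. frag_cmul (c k) (z k)) = 0" for c
    using z by (auto intro!: keys_lincomb simp: bd_sum bd_linear cycles_def)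
  have cone_x_keys: "Poly_Mapping.keys (cone x c) \<subseteq> faces (insert x X) (j + 1)"
    if "Poly_Mapping.keys c \<subseteq> faces L j" for c j
    by (rule keys_cone [OF that]) (use compx LX in auto)
  have cone_v_keys: "Poly_Mapping.keys (cone v c) \<subseteq> faces X (j + 1)"
    if "Poly_Mapping.keys c \<subseteq> faces L j" for c j
    by (rule keys_cone [OF that]) (use compv LX v in auto)
  have X_keys: "Poly_Mapping.keys c \<subseteq> faces (insert x X) j" if "Poly_Mapping.keys c \<subseteq> faces X j" for c j
    using that faces_mono [of X "insert x X" j] by blast
  have L_keys: "Poly_Mapping.keys c \<subseteq> faces X j" if "Poly_Mapping.keys c \<subseteq> faces L j" for c j
    using that faces_mono [OF LX, of j] by blast
  have avoid: "Poly_Mapping.keys c \<subseteq> {\<sigma>. x \<notin> \<sigma>}" if "Poly_Mapping.keys c \<subseteq> faces X j" for c j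
  proof -
    have "faces X j \<subseteq> {\<sigma>. x \<notin> \<sigma>}" using xX by (auto simp: faces_iff)
    then show ?thesis using that by (rule order_trans [rotated])
  qed
  have bd_cone_x: "bd (cone x c) = c - cone x (bd c)" if "Poly_Mapping.keys c \<subseteq> faces L j" for c j
    using cone_homotopy_faces [OF that compx] .
  have bd_cone_v: "bd (cone v c) = c - cone v (bd c)" if "Poly_Mapping.keys c \<subseteq> faces L j" for c j
    using cone_homotopy_faces [OF that compv] .
  have bd_keys: "Poly_Mapping.keys (bd c) \<subseteq> faces Y i" if "Poly_Mapping.keys c \<subseteq> faces Y (i + 1)" for c Y
    using keys_bd [OF that] by simp
  have "s k \<in> cycles (insert x X) i" if "k < p + q" for k
  proof (cases "k < p")
    case True
    then show ?thesis using z [OF True] X_keys [of "z k" i] by (simp add: s_def cycles_def)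
  next
    case False
    then have k: "k - p < q" using that by auto
    have "Poly_Mapping.keys (s k) \<subseteq> faces (insert x X) (i - 1 + 1)"
      using keys_minus_subset [OF cone_x_keys [OF wk(1) [OF k]] X_keys [OF cone_v_keys [OF wk(1) [OF k]]]]
      by (simp add: s_def False)
    moreover have "bd (s k) = 0"
      by (simp add: s_def False bd_linear bd_cone_x [OF wk(1) [OF k]] bd_cone_v [OF wk(1) [OF k]]
          wk(2) [OF k] cone_linear)
    ultimately show ?thesis by (simp add: cycles_def)
  qed
  moreover have "\<exists>c. y - (\<Sum>k<p + q. frag_cmul (c k) (s k)) \<in> boundaries (insert x X) i"
    if "y \<in> cycles (insert x X) i" for y
  proof -
    have y: "Poly_Mapping.keys y \<subseteq> faces (insert x X) i" "bd y = 0" using that by (auto simp: cycles_def)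
    obtain \<alpha> \<beta> where \<alpha>: "Poly_Mapping.keys \<alpha> \<subseteq> faces L (i - 1)"
      and \<beta>: "Poly_Mapping.keys \<beta> \<subseteq> faces X i" and y_eq: "y = cone x \<alpha> + \<beta>"
      using chain_split_vertex [OF y(1) xX] unfolding L_def by blast
    \<comment> \<open>the faces through \<open>x\<close> and the other ones have to cancel separately in \<open>\<partial>y = 0\<close>\<close>
    have eq: "cone x (- bd \<alpha>) + (\<alpha> + bd \<beta>) = 0"
      using y(2) by (simp add: y_eq bd_linear bd_cone_x [OF \<alpha>] cone_linear algebra_simps)
    have k1: "Poly_Mapping.keys (- bd \<alpha>) \<subseteq> {\<sigma>. x \<notin> \<sigma>}"
      using avoid [OF L_keys [OF keys_bd [OF \<alpha>]]] by simp
    have k2: "Poly_Mapping.keys (\<alpha> + bd \<beta>) \<subseteq> {\<sigma>. x \<notin> \<sigma>}"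
      using avoid [OF L_keys [OF \<alpha>]] avoid [OF keys_bd [OF \<beta>]] by (intro keys_plus)
    have bd\<alpha>: "bd \<alpha> = 0" and \<alpha>\<beta>: "\<alpha> + bd \<beta> = 0"
      using cone_eq_zeroD [OF eq k1 k2] by simp_all
    have "\<alpha> \<in> cycles L (i - 1)" using \<alpha> bd\<alpha> by (simp add: cycles_def)
    then obtain c where "\<alpha> - (\<Sum>k<q. frag_cmul (c k) (w k)) \<in> boundaries L (i - 1)"
      using w_span by blast
    then obtain \<gamma> where \<gamma>: "Poly_Mapping.keys \<gamma> \<subseteq> faces L i"
      and c: "\<alpha> - (\<Sum>k<q. frag_cmul (c k) (w k)) = bd \<gamma>"
      by (auto simp: boundaries_def)
    define A where "A = (\<Sum>k<q. frag_cmul (c k) (w k))"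
    have A: "Poly_Mapping.keys A \<subseteq> faces L (i - 1)" "bd A = 0" and \<alpha>_eq: "\<alpha> = A + bd \<gamma>"
      using lcw c by (simp_all add: A_def algebra_simps)
    \<comment> \<open>\<open>y'\<close> is homologous to \<open>y\<close> minus its suspended part, and avoids \<open>x\<close>\<close>
    define y' where "y' = cone v A + \<gamma> + \<beta>"
    have "bd y' = 0"
      using \<alpha>\<beta> A by (simp add: y'_def bd_linear bd_cone_v [OF A(1)] cone_linear \<alpha>_eq)
    moreover have "Poly_Mapping.keys y' \<subseteq> faces X i"
      unfolding y'_def using cone_v_keys [OF A(1)] L_keys [OF \<gamma>] \<beta> by (intro keys_plus) simp_all
    ultimately have "y' \<in> cycles X i" by (simp add: cycles_def)
    then obtain d where "y' - (\<Sum>k<p. frag_cmul (d k) (z k)) \<in> boundaries X i"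
      using z_span by blast
    then obtain \<delta> where \<delta>: "Poly_Mapping.keys \<delta> \<subseteq> faces X (i + 1)"
      and d: "y' - (\<Sum>k<p. frag_cmul (d k) (z k)) = bd \<delta>"
      by (auto simp: boundaries_def)
    define e where "e k = (if k < p then d k else c (k - p))" for k
    have lc: "(\<Sum>k<p + q. frag_cmul (e k) (s k)) =
        (\<Sum>k<p. frag_cmul (d k) (z k)) + (cone x A - cone v A)"
      unfolding s_lincomb by (simp add: e_def A_def)
    have "cone x (bd \<gamma>) = \<gamma> - bd (cone x \<gamma>)" by (simp add: bd_cone_x [OF \<gamma>])
    moreover have "(\<Sum>k<p. frag_cmul (d k) (z k)) = y' - bd \<delta>" using d by (simp add: algebra_simps)
    ultimately have "y - (\<Sum>k<p + q. frag_cmul (e k) (s k)) = bd (\<delta> - cone x \<gamma>)"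
      unfolding lc by (simp add: y_eq \<alpha>_eq y'_def cone_linear bd_linear)
    moreover have "Poly_Mapping.keys (\<delta> - cone x \<gamma>) \<subseteq> faces (insert x X) (i + 1)"
      using X_keys [OF \<delta>] cone_x_keys [OF \<gamma>] by (rule keys_minus_subset)
    ultimately show ?thesis unfolding boundaries_def by blast
  qed
  moreover have "\<forall>k<p + q. c k = 0"
    if bdry: "(\<Sum>k<p + q. frag_cmul (c k) (s k)) \<in> boundaries (insert x X) i" for c
  proof -
    define A where "A = (\<Sum>k<q. frag_cmul (c (p + k)) (w k))"
    define Z where "Z = (\<Sum>k<p. frag_cmul (c k) (z k))"
    have A: "Poly_Mapping.keys A \<subseteq> faces L (i - 1)" "bd A = 0" using lcw by (simp_all add: A_def)
    have Z: "Poly_Mapping.keys Z \<subseteq> faces X i" "bd Z = 0" using lcz by (simp_all add: Z_def)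
    obtain y where y: "Poly_Mapping.keys y \<subseteq> faces (insert x X) (i + 1)"
      and y_eq: "Z + (cone x A - cone v A) = bd y"
      using bdry unfolding s_lincomb A_def Z_def boundaries_def by blast
    obtain \<gamma> \<delta> where \<gamma>: "Poly_Mapping.keys \<gamma> \<subseteq> faces L i"
      and \<delta>: "Poly_Mapping.keys \<delta> \<subseteq> faces X (i + 1)" and y_split: "y = cone x \<gamma> + \<delta>"
      using chain_split_vertex [OF y xX] unfolding L_def by auto
    have eq: "cone x (A + bd \<gamma>) + (Z - cone v A - \<gamma> - bd \<delta>) = 0"
      using y_eq by (simp add: y_split bd_linear bd_cone_x [OF \<gamma>] cone_linear algebra_simps)
    have k1: "Poly_Mapping.keys (A + bd \<gamma>) \<subseteq> {\<sigma>. x \<notin> \<sigma>}"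
      using avoid [OF L_keys [OF A(1)]] avoid [OF L_keys [OF keys_bd [OF \<gamma>]]] by (intro keys_plus)
    have k2: "Poly_Mapping.keys (Z - cone v A - \<gamma> - bd \<delta>) \<subseteq> {\<sigma>. x \<notin> \<sigma>}"
      using avoid [OF Z(1)] avoid [OF cone_v_keys [OF A(1)]] avoid [OF L_keys [OF \<gamma>]] avoid [OF bd_keys [OF \<delta>]]
      by (intro keys_minus_subset)
    have A\<gamma>: "A + bd \<gamma> = 0" and Z_eq: "Z - cone v A - \<gamma> - bd \<delta> = 0"
      using cone_eq_zeroD [OF eq k1 k2] by simp_all
    have "A = bd (- \<gamma>)" using A\<gamma> by (simp add: bd_linear eq_neg_iff_add_eq_0)
    then have "A \<in> boundaries L (i - 1)" using \<gamma> by (auto simp: boundaries_def)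
    then have c_q: "\<forall>k<q. c (p + k) = 0" unfolding A_def by (rule w_indep)
    then have "A = 0" by (simp add: A_def)
    \<comment> \<open>now \<open>\<gamma>\<close> is a cycle of the link, hence bounds its cone over \<open>v\<close>\<close>
    then have "bd \<gamma> = 0" using A\<gamma> by simp
    then have "Z = bd (cone v \<gamma> + \<delta>)"
      using Z_eq by (simp add: \<open>A = 0\<close> bd_linear bd_cone_v [OF \<gamma>] cone_linear algebra_simps)
    moreover have "Poly_Mapping.keys (cone v \<gamma> + \<delta>) \<subseteq> faces X (i + 1)"
      using cone_v_keys [OF \<gamma>] \<delta> by (rule keys_plus)
    ultimately have "Z \<in> boundaries X i" unfolding boundaries_def by blast
    then have "\<forall>k<p. c k = 0" unfolding Z_def by (rule z_indep)
    with c_q show ?thesis by (metis add_diff_inverse_nat nat_add_left_cancel_less)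
  qed
  ultimately show ?thesis unfolding free_homology_def by blast
qed

lemma free_homology_cone:
  assumes "v \<in> X" "\<And>y. y \<in> X \<Longrightarrow> comparable y v"
  shows "free_homology X i 0"
proof -
  have "y \<in> boundaries X i" if "y \<in> cycles X i" for y
  proof -
    have y: "Poly_Mapping.keys y \<subseteq> faces X i" "bd y = 0" using that by (auto simp: cycles_def)
    have "y = bd (cone v y)"
      using cone_homotopy_faces [OF y(1) assms(2)] y(2) by (simp add: cone_linear)
    moreover have "Poly_Mapping.keys (cone v y) \<subseteq> faces X (i + 1)"
      by (rule keys_cone [OF y(1)]) (use assms in auto)
    ultimately show ?thesis unfolding boundaries_def by blast
  qed
  then show ?thesis by (simp add: free_homology_def)
qed

lemma free_homology_negative: "i < -1 \<Longrightarrow> free_homology X i 0"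
proof -
  assume "i < -1"
  then have "faces X i = {}" by (auto simp: faces_iff)
  then have "cycles X i \<subseteq> {0}" by (auto simp: cycles_def)
  moreover have "0 \<in> boundaries X i" by (force simp: boundaries_def bd_linear intro: image_eqI [of _ _ 0])
  ultimately show ?thesis by (auto simp: free_homology_def)
qed

text \<open>The empty face is a cycle of degree \<open>-1\<close>, and without vertices it does not bound.\<close>

lemma free_homology_empty:
  "free_homology {} i (if i = -1 then 1 else 0)"
proof -
  have bnd: "0 \<in> boundaries {} i" by (force simp: boundaries_def bd_linear intro: image_eqI [of _ _ 0])
  show ?thesis
  proof (cases "i = -1")
    case False
    then have "faces {} i = {}" by (auto simp: faces_iff)
    then have "cycles {} i \<subseteq> {0}" by (auto simp: cycles_def)
    then show ?thesis using bnd False by (auto simp: free_homology_def)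
  next
    case True
    have f: "faces {} (-1) = {{}}" "faces {} 0 = {}" by (auto simp: faces_iff)
    have b: "boundaries {} (-1) = {0}" by (auto simp: boundaries_def f bd_linear)
    have cyc: "\<exists>k. c = frag_cmul k (frag_of {})" if "c \<in> cycles {} (-1)" for c
    proof
      show "c = frag_cmul (Poly_Mapping.lookup c {}) (frag_of {})"
        using that f by (auto simp: cycles_def poly_mapping_eq_iff fun_eq_iff in_keys_iff subset_iff)
    qed
    have "frag_of {} \<in> cycles {} (-1)" by (simp add: cycles_def f bd_frag_of)
    then show ?thesis
      using True cyc unfolding free_homology_def
      by (intro exI [of _ "\<lambda>_. frag_of {}"]) (fastforce simp: b)
  qed
qed

text \<open>
  Pairwise incomparable points do not occur in each other's links, so adding one of them leaves the
  links of the others unchanged.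
\<close>

lemma free_homology_attach:
  assumes "finite M" and "M \<inter> X = {}"
    and "free_homology X i p"
    and "\<And>x y. x \<in> M \<Longrightarrow> y \<in> M \<Longrightarrow> x \<noteq> y \<Longrightarrow> \<not> comparable x y"
    and "\<And>x. x \<in> M \<Longrightarrow> v x \<in> X"
    and "\<And>x y. x \<in> M \<Longrightarrow> y \<in> link X x \<Longrightarrow> comparable y (v x)"
    and "\<And>x. x \<in> M \<Longrightarrow> free_homology (link X x) (i - 1) (q x)"
  shows "free_homology (X \<union> M) i (p + (\<Sum>x\<in>M. q x))"
  using assms
proof (induction M rule: finite_induct)
  case empty
  then show ?case by simp
next
  case (insert x M)
  have IH: "free_homology (X \<union> M) i (p + (\<Sum>x\<in>M. q x))"
    using insert.prems by (intro insert.IH) auto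
  have link_eq: "link (X \<union> M) x = link X x"
    using insert.prems(3) insert.hyps by (auto simp: link_def)
  have "free_homology (insert x (X \<union> M)) i ((p + (\<Sum>x\<in>M. q x)) + q x)"
  proof (rule free_homology_insert [OF _ _ _ IH])
    show "x \<notin> X \<union> M" using insert by auto
    show "v x \<in> X \<union> M" using insert.prems by auto
  qed (use insert.prems in \<open>auto simp: link_eq\<close>)
  then show ?case using insert.hyps by (simp add: add_ac)
qed

text \<open>
  Here the points of \<open>M\<close> may be comparable to each other.  The apex \<open>v x\<close> is required to be comparable to
  the whole link of \<open>x\<close> in \<open>X \<union> M\<close>, so it cones off the link of \<open>x\<close> at whatever moment \<open>x\<close> is added.
\<close>

lemma free_homology_beat_points:
  assumes "finite M" and "M \<inter> X = {}"
    and "free_homology X i p"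
    and "\<And>x. x \<in> M \<Longrightarrow> v x \<in> link X x"
    and "\<And>x y. x \<in> M \<Longrightarrow> y \<in> link (X \<union> M) x \<Longrightarrow> comparable y (v x)"
  shows "free_homology (X \<union> M) i p"
  using assms
proof (induction M rule: finite_induct)
  case empty
  then show ?case by simp
next
  case (insert x M)
  have sub: "link (X \<union> M) y \<subseteq> link (X \<union> insert x M) y" for y by (auto simp: link_def)
  have IH: "free_homology (X \<union> M) i p"
    using insert.prems subsetD [OF sub] by (intro insert.IH) auto
  have vx: "v x \<in> link (X \<union> M) x" using insert.prems(3) [of x] by (auto simp: link_def)
  have comp: "comparable y (v x)" if "y \<in> link (X \<union> M) x" for y
    using insert.prems(4) [of x y] that sub by auto
  have "free_homology (insert x (X \<union> M)) i (p + 0)"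
  proof (rule free_homology_insert [OF _ _ comp IH])
    show "x \<notin> X \<union> M" using insert by auto
    show "v x \<in> X \<union> M" using vx by (auto simp: link_def)
    show "free_homology (link (X \<union> M) x) (i - 1) 0" using vx comp by (rule free_homology_cone)
  qed
  then show ?case by simp
qed

end

section \<open>The rank of the homology group\<close>

text \<open>
  More than \<open>n\<close> integer vectors of length \<open>n\<close> are linearly dependent over the integers: cross-multiplying
  with a pivot \<open>M x0 n\<close> eliminates the last coordinate without any division.
\<close>

lemma integer_dependency:
  fixes M :: "'a \<Rightarrow> nat \<Rightarrow> int"
  assumes "finite S" "n < card S"
  shows "\<exists>c. (\<exists>x\<in>S. c x \<noteq> 0) \<and> (\<forall>k<n. (\<Sum>x\<in>S. c x * M x k) = 0)"
  using assms
proof (induction n arbitrary: S M)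
  case 0
  then have "S \<noteq> {}" by auto
  then show ?case by (intro exI [of _ "\<lambda>_. 1"]) auto
next
  case (Suc n)
  show ?case
  proof (cases "\<forall>x\<in>S. M x n = 0")
    case True
    obtain c where "\<exists>x\<in>S. c x \<noteq> 0" "\<forall>k<n. (\<Sum>x\<in>S. c x * M x k) = 0"
      using Suc.IH [of S M] Suc.prems by auto
    moreover have "(\<Sum>x\<in>S. c x * M x n) = 0" using True by simp
    ultimately show ?thesis by (metis less_Suc_eq)
  next
    case False
    then obtain x0 where x0: "x0 \<in> S" "M x0 n \<noteq> 0" by blast
    define T where "T = S - {x0}"
    have T: "finite T" "n < card T" "x0 \<notin> T" "S = insert x0 T"
      using Suc.prems x0 by (auto simp: T_def)
    obtain c where c: "\<exists>x\<in>T. c x \<noteq> 0"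
      and dep: "\<And>k. k < n \<Longrightarrow> (\<Sum>x\<in>T. c x * (M x0 n * M x k - M x n * M x0 k)) = 0"
      using Suc.IH [OF T(1,2), of "\<lambda>x k. M x0 n * M x k - M x n * M x0 k"] by blast
    define d where "d x = (if x = x0 then - (\<Sum>y\<in>T. c y * M y n) else M x0 n * c x)" for x
    have sum_d: "(\<Sum>x\<in>S. d x * M x k) = (\<Sum>x\<in>T. c x * (M x0 n * M x k - M x n * M x0 k))" for k
    proof -
      have "(\<Sum>x\<in>T. d x * M x k) = (\<Sum>x\<in>T. M x0 n * c x * M x k)"
        by (rule sum.cong) (use T(3) in \<open>auto simp: d_def\<close>)
      moreover have "d x0 * M x0 k = - (\<Sum>x\<in>T. c x * M x n * M x0 k)"
        by (simp add: d_def sum_distrib_right)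
      ultimately show ?thesis
        using T by (simp add: sum_subtractf right_diff_distrib mult_ac)
    qed
    have "(\<Sum>x\<in>S. d x * M x k) = 0" if "k < Suc n" for k
      using that dep unfolding sum_d by (cases "k = n") (auto simp: mult_ac)
    moreover have "\<exists>x\<in>S. d x \<noteq> 0" using c T x0 by (auto simp: d_def)
    ultimately show ?thesis by blast
  qed
qed

text \<open>
  A multiplicatively written group \<open>H\<close> that is the quotient of a group \<open>Z\<close> of integer combinations by
  a subgroup \<open>B\<close>.  It allows products of powers in \<open>H\<close> to be computed as linear combinations in \<open>Z\<close>.
\<close>

locale frag_quotient = comm_group H for H :: "('b, 'm) monoid_scheme" (structure) +
  fixes Z B :: "('c \<Rightarrow>\<^sub>0 int) set" and \<pi> :: "('c \<Rightarrow>\<^sub>0 int) \<Rightarrow> 'b"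
  assumes carrier_eq: "carrier H = \<pi> ` Z"
    and Z_zero: "0 \<in> Z" and Z_add: "\<And>x y. x \<in> Z \<Longrightarrow> y \<in> Z \<Longrightarrow> x + y \<in> Z"
    and Z_cmul: "\<And>x k. x \<in> Z \<Longrightarrow> frag_cmul k x \<in> Z"
    and B_zero: "0 \<in> B" and B_add: "\<And>x y. x \<in> B \<Longrightarrow> y \<in> B \<Longrightarrow> x + y \<in> B"
    and B_cmul: "\<And>x k. x \<in> B \<Longrightarrow> frag_cmul k x \<in> B"
    and \<pi>_add: "\<And>x y. x \<in> Z \<Longrightarrow> y \<in> Z \<Longrightarrow> \<pi> (x + y) = \<pi> x \<otimes> \<pi> y"
    and \<pi>_cmul: "\<And>x k. x \<in> Z \<Longrightarrow> \<pi> (frag_cmul k x) = \<pi> x [^] (k::int)"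
    and \<pi>_one: "\<And>x. x \<in> Z \<Longrightarrow> \<pi> x = \<one> \<longleftrightarrow> x \<in> B"
begin

lemma Z_sum:
  assumes "\<And>x. x \<in> S \<Longrightarrow> r x \<in> Z"
  shows "(\<Sum>x\<in>S. frag_cmul (c x) (r x)) \<in> Z"
  using assms by (induction S rule: infinite_finite_induct) (auto simp: Z_zero Z_add Z_cmul)

lemma B_sum:
  assumes "\<And>x. x \<in> S \<Longrightarrow> r x \<in> B"
  shows "(\<Sum>x\<in>S. frag_cmul (c x) (r x)) \<in> B"
  using assms by (induction S rule: infinite_finite_induct) (auto simp: B_zero B_add B_cmul)

lemma \<pi>_closed: "x \<in> Z \<Longrightarrow> \<pi> x \<in> carrier H"
  by (simp add: carrier_eq)

lemma finprod_\<pi>: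
  assumes "finite S" "\<And>x. x \<in> S \<Longrightarrow> r x \<in> Z"
  shows "finprod H (\<lambda>x. \<pi> (r x) [^] c x) S = \<pi> (\<Sum>x\<in>S. frag_cmul (c x) (r x))"
  using assms
proof (induction S rule: finite_induct)
  case empty
  then show ?case using \<pi>_one [OF Z_zero] B_zero by simp
next
  case (insert x S)
  have "(\<lambda>x. \<pi> (r x) [^] c x) \<in> S \<rightarrow> carrier H" "\<pi> (r x) [^] c x \<in> carrier H"
    using insert.prems by (auto intro!: int_pow_closed \<pi>_closed)
  then show ?case
    using insert by (simp add: finprod_insert \<pi>_add Z_sum Z_cmul \<pi>_cmul)
qed

lemma Z_independent_iff:
  assumes "finite S" "S \<subseteq> carrier H" "\<And>x. x \<in> S \<Longrightarrow> r x \<in> Z" "\<And>x. x \<in> S \<Longrightarrow> \<pi> (r x) = x"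
  shows "Z_independent H S \<longleftrightarrow>
    (\<forall>c. (\<Sum>x\<in>S. frag_cmul (c x) (r x)) \<in> B \<longrightarrow> (\<forall>x\<in>S. c x = 0))"
proof -
  have "finprod H (\<lambda>x. x [^] c x) S = \<pi> (\<Sum>x\<in>S. frag_cmul (c x) (r x))" for c :: "'b \<Rightarrow> int"
  proof -
    have "finprod H (\<lambda>x. x [^] c x) S = finprod H (\<lambda>x. \<pi> (r x) [^] c x) S"
      by (rule finprod_cong') (use assms in \<open>auto intro!: int_pow_closed \<pi>_closed\<close>)
    then show ?thesis using finprod_\<pi> [OF assms(1,3)] by simp
  qed
  then show ?thesis
    using assms \<pi>_one [OF Z_sum [of S r]] by (simp add: Z_independent_def)
qed

text \<open>
  Writing the elements of an independent family in terms of the basis gives integer vectors of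
  length \<open>n\<close>, so \<open>integer_dependency\<close> bounds the size of the family.
\<close>

lemma abelian_rank_eq:
  assumes z: "\<And>k. k < n \<Longrightarrow> z k \<in> Z"
    and span: "\<And>y. y \<in> Z \<Longrightarrow> \<exists>c. y - (\<Sum>k<n. frag_cmul (c k) (z k)) \<in> B"
    and indep: "\<And>c. (\<Sum>k<n. frag_cmul (c k) (z k)) \<in> B \<Longrightarrow> \<forall>k<n. c k = 0"
  shows "abelian_rank H = enat n"
proof (rule antisym)
  show "abelian_rank H \<le> enat n"
    unfolding abelian_rank_def
  proof (rule SUP_least)
    fix S assume "S \<in> {S. Z_independent H S}"
    then have S: "Z_independent H S" "finite S" "S \<subseteq> carrier H" by (auto simp: Z_independent_def)
    then have "\<forall>x\<in>S. \<exists>y. y \<in> Z \<and> \<pi> y = x" by (auto simp: carrier_eq)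
    then obtain r where r: "\<And>x. x \<in> S \<Longrightarrow> r x \<in> Z" "\<And>x. x \<in> S \<Longrightarrow> \<pi> (r x) = x" by metis
    have "\<forall>x\<in>S. \<exists>c. r x - (\<Sum>k<n. frag_cmul (c k) (z k)) \<in> B" using span r by blast
    then obtain M where M: "\<And>x. x \<in> S \<Longrightarrow> r x - (\<Sum>k<n. frag_cmul (M x k) (z k)) \<in> B" by metis
    show "enat (card S) \<le> enat n"
    proof (rule ccontr)
      assume "\<not> enat (card S) \<le> enat n"
      then obtain c where c: "\<exists>x\<in>S. c x \<noteq> 0" "\<And>k. k < n \<Longrightarrow> (\<Sum>x\<in>S. c x * M x k) = 0"
        using integer_dependency [of S n M] S by auto
      have "(\<Sum>x\<in>S. frag_cmul (c x) (\<Sum>k<n. frag_cmul (M x k) (z k))) =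
          (\<Sum>k<n. \<Sum>x\<in>S. frag_cmul (c x * M x k) (z k))"
        by (subst sum.swap) (simp add: frag_cmul_sum)
      also have "\<dots> = (\<Sum>k<n. frag_cmul (\<Sum>x\<in>S. c x * M x k) (z k))"
        by (rule sum.cong) (auto simp: poly_mapping_eq_iff fun_eq_iff lookup_sum sum_distrib_right)
      also have "\<dots> = 0" using c(2) by simp
      finally have "(\<Sum>x\<in>S. frag_cmul (c x) (r x)) =
          (\<Sum>x\<in>S. frag_cmul (c x) (r x - (\<Sum>k<n. frag_cmul (M x k) (z k))))"
        by (simp add: frag_cmul_diff sum_subtractf)
      also have "\<dots> \<in> B" by (rule B_sum) (rule M)
      finally have "\<forall>x\<in>S. c x = 0" using Z_independent_iff [OF S(2,3) r] S(1) by blast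
      then show False using c(1) by blast
    qed
  qed
next
  have inj: "inj_on (\<lambda>k. \<pi> (z k)) {..<n}"
  proof (rule inj_onI, rule ccontr)
    fix j k assume jk: "j \<in> {..<n}" "k \<in> {..<n}" "\<pi> (z j) = \<pi> (z k)" "j \<noteq> k"
    have zk: "frag_cmul (-1) (z k) \<in> Z" using jk z Z_cmul by blast
    have "\<pi> (z j + frag_cmul (-1) (z k)) = \<pi> (z k) \<otimes> \<pi> (z k) [^] (-1::int)"
      using jk z zk \<pi>_cmul [of "z k" "-1"] by (simp add: \<pi>_add del: frag_cmul_minus_one)
    also have "\<dots> = \<pi> (z k + frag_cmul (-1) (z k))"
      using jk z zk \<pi>_cmul [of "z k" "-1"] by (simp add: \<pi>_add del: frag_cmul_minus_one)
    also have "\<dots> = \<one>" using \<pi>_one [OF Z_zero] B_zero by simp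
    finally have "\<pi> (z j + frag_cmul (-1) (z k)) = \<one>" .
    moreover have "z j + frag_cmul (-1) (z k) \<in> Z" using z zk jk by (intro Z_add) auto
    ultimately have "z j + frag_cmul (-1) (z k) \<in> B" using \<pi>_one by blast
    moreover have "(\<Sum>l<n. frag_cmul (of_bool (l = j) - of_bool (l = k)) (z l)) = z j + frag_cmul (-1) (z k)"
    proof -
      have "frag_cmul (of_bool (l = j) - of_bool (l = k)) (z l) =
          (if l = j then z l else 0) - (if l = k then z l else 0)" for l
        using jk(4) by auto
      then show ?thesis using jk by (simp add: sum_subtractf)
    qed
    ultimately have "(\<Sum>l<n. frag_cmul (of_bool (l = j) - of_bool (l = k)) (z l)) \<in> B" by (simp only:)
    from indep [OF this] have "of_bool (j = j) - of_bool (j = k) = (0::int)" using jk by blast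
    then show False using jk by simp
  qed
  define S where "S = (\<lambda>k. \<pi> (z k)) ` {..<n}"
  define r where "r x = z (inv_into {..<n} (\<lambda>k. \<pi> (z k)) x)" for x
  have r_eq: "r (\<pi> (z k)) = z k" if "k < n" for k
    using inv_into_f_f [OF inj, of k] that by (simp add: r_def)
  have "Z_independent H S \<longleftrightarrow>
      (\<forall>c. (\<Sum>x\<in>S. frag_cmul (c x) (r x)) \<in> B \<longrightarrow> (\<forall>x\<in>S. c x = 0))"
    by (rule Z_independent_iff) (use z r_eq \<pi>_closed in \<open>auto simp: S_def\<close>)
  moreover have "(\<Sum>x\<in>S. frag_cmul (c x) (r x)) = (\<Sum>k<n. frag_cmul (c (\<pi> (z k))) (z k))" for c
    unfolding S_def by (simp add: sum.reindex [OF inj] r_eq)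
  moreover have "\<forall>x\<in>S. c x = 0" if "(\<Sum>k<n. frag_cmul (c (\<pi> (z k))) (z k)) \<in> B" for c
    using indep [OF that] by (auto simp: S_def)
  ultimately have "Z_independent H S" by simp
  moreover have "card S = n" by (simp add: S_def card_image [OF inj])
  ultimately show "enat n \<le> abelian_rank H"
    unfolding abelian_rank_def by (metis SUP_upper mem_Collect_eq)
qed

end

context refl_antisym begin

lemma cycles_subspace:
  "0 \<in> cycles X i" "x \<in> cycles X i \<Longrightarrow> y \<in> cycles X i \<Longrightarrow> x + y \<in> cycles X i"
  "x \<in> cycles X i \<Longrightarrow> frag_cmul k x \<in> cycles X i"
  by (simp_all add: cycles_def bd_linear keys_plus order_trans [OF keys_cmul])

lemma boundaries_subspace:
  "0 \<in> boundaries X i" "x \<in> boundaries X i \<Longrightarrow> y \<in> boundaries X i \<Longrightarrow> x + y \<in> boundaries X i"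
  "x \<in> boundaries X i \<Longrightarrow> frag_cmul k x \<in> boundaries X i"
proof -
  show "0 \<in> boundaries X i" by (auto simp: boundaries_def bd_linear intro: image_eqI [of _ _ 0])
  show "x + y \<in> boundaries X i" if xy: "x \<in> boundaries X i" "y \<in> boundaries X i"
  proof -
    obtain u v where "Poly_Mapping.keys u \<subseteq> faces X (i + 1)" "Poly_Mapping.keys v \<subseteq> faces X (i + 1)"
      "x = bd u" "y = bd v" using xy by (auto simp: boundaries_def)
    then show ?thesis unfolding boundaries_def
      by (intro image_eqI [of _ _ "u + v"]) (simp_all add: bd_linear keys_plus)
  qed
  show "frag_cmul k x \<in> boundaries X i" if "x \<in> boundaries X i"
    using that unfolding boundaries_def by (force simp flip: bd_linear(5))
qed

lemma boundaries_subset_cycles: "boundaries X i \<subseteq> cycles X i"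
proof
  fix y assume "y \<in> boundaries X i"
  then obtain c where c: "Poly_Mapping.keys c \<subseteq> faces X (i + 1)" "y = bd c"
    by (auto simp: boundaries_def)
  then show "y \<in> cycles X i"
    using keys_bd [OF c(1)] bd_bd [OF c(1)] by (simp add: cycles_def)
qed

abbreviation homology :: "'a set \<Rightarrow> int \<Rightarrow> ('a set \<Rightarrow>\<^sub>0 int) set monoid" where
  "homology X i \<equiv> reduced_simplicial_homology lt (order_complex le X) i"

text \<open>The projection is the map that sends a cycle to its coset modulo boundaries.\<close>

lemma frag_quotient_homology:
  "\<exists>\<pi>. frag_quotient (homology X i) (cycles X i) (boundaries X i) \<pi>"
proof -
  define G where "G = simplicial_chain_group (order_complex le X) i"
  have G: "comm_group G" by (simp add: G_def simplicial_chain_group_def abelian_free_Abelian_group)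
  then interpret G: comm_group G .
  have G_simps: "carrier G = {c. Poly_Mapping.keys c \<subseteq> faces X i}" "\<one>\<^bsub>G\<^esub> = 0" "\<And>x y. x \<otimes>\<^bsub>G\<^esub> y = x + y"
    by (auto simp: G_def simplicial_chain_group_def)
  have G_inv: "inv\<^bsub>G\<^esub> x = - x" if "Poly_Mapping.keys x \<subseteq> faces X i" for x
    using that by (simp add: G_def simplicial_chain_group_def)
  have G_pow: "x [^]\<^bsub>G\<^esub> (k::int) = frag_cmul k x" if "Poly_Mapping.keys x \<subseteq> faces X i" for x k
    using that by (simp add: G_def simplicial_chain_group_def)
  define Z where "Z = subgroup_generated G (cycles X i)"
  have sub_Z: "subgroup (cycles X i) G"
  proof (rule G.subgroupI)
    show "inv\<^bsub>G\<^esub> x \<in> cycles X i" if "x \<in> cycles X i" for x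
      using that cycles_subspace(3) [OF that, of "-1"] by (simp add: G_inv cycles_def)
  qed (use cycles_subspace [where X = X and i = i] in \<open>auto simp: G_simps cycles_def\<close>)
  have Z_carrier: "carrier Z = cycles X i"
    unfolding Z_def by (rule subgroup.carrier_subgroup_generated_subgroup [OF sub_Z])
  have Z_comm: "comm_group Z" unfolding Z_def by (rule G.abelian_subgroup_generated [OF G])
  then interpret Z: comm_group Z .
  have Z_simps: "\<one>\<^bsub>Z\<^esub> = 0" "\<And>x y. x \<otimes>\<^bsub>Z\<^esub> y = x + y" by (simp_all add: Z_def G_simps)
  have Z_pow: "x [^]\<^bsub>Z\<^esub> (k::int) = frag_cmul k x" if "x \<in> cycles X i" for x k
    using that G_pow G.int_pow_subgroup_generated [of x "cycles X i" k] Z_carrier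
    by (simp add: Z_def cycles_def)
  have sub_B: "subgroup (boundaries X i) Z"
  proof (rule Z.subgroupI)
    show "inv\<^bsub>Z\<^esub> x \<in> boundaries X i" if "x \<in> boundaries X i" for x
    proof -
      have x: "x \<in> cycles X i" using that boundaries_subset_cycles by blast
      have "inv\<^bsub>Z\<^esub> x = - x"
        by (rule Z.inv_equality)
          (use x cycles_subspace(3) [OF x, of "-1"] in \<open>simp_all add: Z_simps Z_carrier\<close>)
      then show ?thesis using boundaries_subspace(3) [OF that, of "-1"] by simp
    qed
  qed (use boundaries_subspace [where X = X and i = i] boundaries_subset_cycles [of X i] in \<open>auto simp: Z_simps Z_carrier\<close>)
  have normal_B: "boundaries X i \<lhd> Z" by (rule Z.subgroup_imp_normal [OF sub_B])
  then interpret B: normal "boundaries X i" Z .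
  have H_eq: "homology X i = Z Mod boundaries X i"
  proof -
    have "simplicial_cycles lt (order_complex le X) i = cycles X i"
      by (auto simp: simplicial_cycles_def cycles_def simplicial_chain_group_def)
    moreover have "simplicial_boundaries lt (order_complex le X) i = boundaries X i"
      by (auto simp: simplicial_boundaries_def boundaries_def simplicial_chain_group_def)
    ultimately show ?thesis by (simp add: reduced_simplicial_homology_def Z_def G_def)
  qed
  define \<pi> where "\<pi> = (\<lambda>y. boundaries X i #>\<^bsub>Z\<^esub> y)"
  have hom: "\<pi> \<in> hom Z (homology X i)" unfolding H_eq \<pi>_def by (rule B.r_coset_hom_Mod)
  have H_comm: "comm_group (homology X i)" unfolding H_eq by (rule Z.abelian_FactGroup [OF sub_B])
  then interpret H: comm_group "homology X i" .
  interpret \<pi>: group_hom Z "homology X i" \<pi> using hom by unfold_locales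
  have "frag_quotient (homology X i) (cycles X i) (boundaries X i) \<pi>"
  proof (unfold_locales)
    show "carrier (homology X i) = \<pi> ` cycles X i"
      by (simp add: H_eq carrier_FactGroup \<pi>_def Z_carrier)
    show "\<pi> (x + y) = \<pi> x \<otimes>\<^bsub>homology X i\<^esub> \<pi> y" if "x \<in> cycles X i" "y \<in> cycles X i" for x y
      using \<pi>.hom_mult [of x y] that by (simp add: Z_carrier Z_simps)
    show "\<pi> (frag_cmul k x) = \<pi> x [^]\<^bsub>homology X i\<^esub> k" if "x \<in> cycles X i" for x k
      using \<pi>.hom_int_pow [of x k] that by (simp add: Z_carrier Z_pow)
    show "\<pi> x = \<one>\<^bsub>homology X i\<^esub> \<longleftrightarrow> x \<in> boundaries X i" if "x \<in> cycles X i" for x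
    proof -
      have x: "x \<in> carrier Z" using that by (simp add: Z_carrier)
      show ?thesis unfolding \<pi>_def H_eq one_FactGroup
        using Z.coset_join1 [OF _ x sub_B] Z.coset_join2 [OF x sub_B] by blast
    qed
  qed (use cycles_subspace boundaries_subspace in auto)
  then show ?thesis by blast
qed

lemma abelian_rank_homology:
  assumes "free_homology X i n"
  shows "abelian_rank (homology X i) = enat n"
proof -
  obtain \<pi> where "frag_quotient (homology X i) (cycles X i) (boundaries X i) \<pi>"
    using frag_quotient_homology [of X i] ..
  then interpret frag_quotient "homology X i" "cycles X i" "boundaries X i" \<pi> .
  obtain z where "\<forall>k<n. z k \<in> cycles X i"
    "\<forall>y\<in>cycles X i. \<exists>c. y - (\<Sum>k<n. frag_cmul (c k) (z k)) \<in> boundaries X i"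
    "\<forall>c. (\<Sum>k<n. frag_cmul (c k) (z k)) \<in> boundaries X i \<longrightarrow> (\<forall>k<n. c k = 0)"
    using assms unfolding free_homology_def by blast
  then show ?thesis by (intro abelian_rank_eq [of n z]) simp_all
qed

lemma trivial_homology:
  assumes "free_homology X i 0"
  shows "trivial_group (homology X i)"
proof -
  obtain \<pi> where "frag_quotient (homology X i) (cycles X i) (boundaries X i) \<pi>"
    using frag_quotient_homology [of X i] ..
  then interpret frag_quotient "homology X i" "cycles X i" "boundaries X i" \<pi> .
  have "cycles X i \<subseteq> boundaries X i" using assms by (auto simp: free_homology_def)
  then have "carrier (homology X i) \<subseteq> {\<one>\<^bsub>homology X i\<^esub>}" using \<pi>_one by (auto simp: carrier_eq)
  then show ?thesis by (simp add: trivial_group_subset)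
qed

end

section \<open>Counting rook paths\<close>

text \<open>
  The number of ways to write \<open>u\<close> as an ordered sum of \<open>t\<close> positive integers.  The convention
  \<open>binom(-1,-1) = 1\<close> accounts for the empty sum.
\<close>

definition compositions :: "nat \<Rightarrow> nat \<Rightarrow> nat" where
  "compositions u t = int_binom (int u - 1) (int t - 1)"

lemma int_binom_nat: "int_binom (int n) (int k) = n choose k"
  by (auto simp: int_binom_def binomial_eq_0)

lemma compositions_simps [simp]:
  "compositions u 0 = of_bool (u = 0)"
  "compositions 0 (Suc t) = 0"
  "compositions (Suc u) (Suc t) = u choose t"
  by (auto simp: compositions_def int_binom_def binomial_eq_0)

lemma sum_compositions: "(\<Sum>j<u. compositions j t) = compositions u (Suc t)"
proof (induction u)
  case (Suc u)
  then show ?case by (cases u; cases t) simp_all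
qed simp

lemma sum_choose: "(\<Sum>j<v. j choose s) = v choose Suc s"
  by (induction v) (simp_all add: add.commute)

text \<open>
  The number of sequences of \<open>k\<close> moves from \<open>(u,v)\<close> to a point on one of the axes, each move lowering
  one of the coordinates.  If \<open>t\<close> of the moves lower the first coordinate, there are \<open>k choose t\<close>
  ways to interleave the two kinds of moves.  Either the first coordinate ends at \<open>0\<close> (\<open>compositions u t\<close>
  possibilities) and the second one is arbitrary (\<open>v choose (k - t)\<close>, the set of values after each
  of its moves), or the first coordinate ends at a positive value, which is then a further summand of \<open>u\<close>,
  and the second one ends at \<open>0\<close>.
\<close>

definition rook_paths :: "nat \<Rightarrow> nat \<Rightarrow> nat \<Rightarrow> nat" where
  "rook_paths k u v = (\<Sum>t\<le>k. (k choose t) *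
     (compositions u t * (v choose (k - t)) + compositions u (Suc t) * compositions v (k - t)))"

lemma rook_paths_0: "rook_paths 0 u v = of_bool (u = 0 \<or> v = 0)"
  by (cases u) (auto simp: rook_paths_def)

text \<open>
  The recursion on the first move.  Summing over the coordinate that moves raises one of the two
  indices of the summand \<open>h\<close>, and Pascal's rule merges the two resulting sums.
\<close>

lemma rook_paths_Suc:
  "rook_paths (Suc k) u v = (\<Sum>j<v. rook_paths k u j) + (\<Sum>j<u. rook_paths k j v)"
proof -
  define h where "h t s = compositions u t * (v choose s) + compositions u (Suc t) * compositions v s" for t s
  have 1: "(\<Sum>j<v. rook_paths k u j) = (\<Sum>t\<le>k. (k choose t) * h t (Suc (k - t)))"
  proof -
    have "(\<Sum>j<v. rook_paths k u j) = (\<Sum>t\<le>k. (k choose t) *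
        (compositions u t * (\<Sum>j<v. j choose (k - t)) + compositions u (Suc t) * (\<Sum>j<v. compositions j (k - t))))"
      unfolding rook_paths_def
      by (subst sum.swap) (simp add: sum.distrib flip: sum_distrib_left)
    then show ?thesis by (simp add: sum_choose sum_compositions h_def)
  qed
  have 2: "(\<Sum>j<u. rook_paths k j v) = (\<Sum>t\<le>k. (k choose t) * h (Suc t) (k - t))"
  proof -
    have "(\<Sum>j<u. rook_paths k j v) = (\<Sum>t\<le>k. (k choose t) *
        ((\<Sum>j<u. compositions j t) * (v choose (k - t)) + (\<Sum>j<u. compositions j (Suc t)) * compositions v (k - t)))"
      unfolding rook_paths_def
      by (subst sum.swap) (simp add: sum.distrib flip: sum_distrib_left sum_distrib_right)
    then show ?thesis by (simp add: sum_compositions h_def)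
  qed
  have "rook_paths (Suc k) u v = h 0 (Suc k) + (\<Sum>t\<le>k. (Suc k choose Suc t) * h (Suc t) (k - t))"
    unfolding rook_paths_def h_def [symmetric] by (subst sum.atMost_Suc_shift) simp
  also have "\<dots> = h 0 (Suc k) + (\<Sum>t\<le>k. (k choose Suc t) * h (Suc t) (k - t)) +
      (\<Sum>t\<le>k. (k choose t) * h (Suc t) (k - t))"
    by (simp add: sum.distrib distrib_right)
  also have "h 0 (Suc k) + (\<Sum>t\<le>k. (k choose Suc t) * h (Suc t) (k - t)) =
      (\<Sum>t\<le>Suc k. (k choose t) * h t (Suc k - t))"
    by (subst sum.atMost_Suc_shift) simp
  also have "\<dots> = (\<Sum>t\<le>k. (k choose t) * h t (Suc (k - t)))"
    by (simp add: binomial_eq_0 Suc_diff_le)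
  finally show ?thesis by (simp add: 1 2)
qed

text \<open>
  Passing to a link shortens both sides of a box by at least one.  Subtracting \<open>k\<close> from both sides
  accounts for \<open>k\<close> such passages, and what remains is a freely moving rook.  If a side is shorter
  than \<open>k\<close>, the box is exhausted earlier.
\<close>

definition box_rank :: "nat \<Rightarrow> nat \<Rightarrow> nat \<Rightarrow> nat" where
  "box_rank k m n = (if k \<le> m \<and> k \<le> n then rook_paths k (m - k) (n - k) else 0)"

lemma box_rank_0: "box_rank 0 m n = of_bool (m = 0 \<or> n = 0)"
  by (simp add: box_rank_def rook_paths_0)

lemma sum_shifted: "(\<Sum>j<n. if k \<le> j then f (j - k) else 0) = (\<Sum>j<n - k. f j)"
  for f :: "nat \<Rightarrow> nat"
  by (induction n) (auto simp: Suc_diff_le)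

lemma box_rank_Suc:
  "box_rank (Suc k) (Suc m) (Suc n) = (\<Sum>j<n. box_rank k m j) + (\<Sum>j<m. box_rank k j n)"
proof (cases "k \<le> m \<and> k \<le> n")
  case True
  have "(\<Sum>j<n. box_rank k m j) = (\<Sum>j<n - k. rook_paths k (m - k) j)"
    using True by (simp add: box_rank_def flip: sum_shifted)
  moreover have "(\<Sum>j<m. box_rank k j n) = (\<Sum>j<m - k. rook_paths k j (n - k))"
    using True by (simp add: box_rank_def flip: sum_shifted)
  ultimately show ?thesis using True by (simp add: box_rank_def rook_paths_Suc)
next
  case False
  then have sums: "(\<Sum>j<n. box_rank k m j) = 0" "(\<Sum>j<m. box_rank k j n) = 0"
    by (auto simp: box_rank_def)
  show ?thesis unfolding sums using False by (auto simp: box_rank_def)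
qed

text \<open>
  The two sums differ by the shift \<open>t \<mapsto> t + 1\<close> in their second parts, which are \<open>w\<close> and \<open>g\<close> in the
  proof.  The boundary term \<open>g k\<close> can only be nonzero for \<open>b - 2 - k = 0\<close>; the assumption \<open>a \<le> b\<close>
  then forces \<open>a - 2 - k = 0\<close> as well, so that the term vanishes after all.
\<close>

lemma box_rank_eq_int_binom:
  fixes a b k :: nat
  assumes "2 \<le> a" "a \<le> b" "k \<le> a - 2"
  shows "box_rank k (a - 2) (b - 2) = (\<Sum>t = 0..int k.
     int_binom (int a - 3 - int k) (t - 1) *
       (int_binom (int k) t * int_binom (int b - 2 - int k) (int k - t) +
        int_binom (int k) (t - 1) * int_binom (int b - 3 - int k) (int k - t)))"
proof -
  define u v where "u = a - 2 - k" and "v = b - 2 - k"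
  have ab: "int a - 3 - int k = int u - 1" "int b - 2 - int k = int v" "int b - 3 - int k = int v - 1"
    using assms by (auto simp: u_def v_def)
  define g where "g t = (k choose t) * (compositions u (Suc t) * compositions v (k - t))" for t
  define w where "w t = (case t of 0 \<Rightarrow> 0 | Suc s \<Rightarrow> if s < k then g s else 0)" for t
  have term_eq: "int_binom (int a - 3 - int k) (int t - 1) *
       (int_binom (int k) (int t) * int_binom (int b - 2 - int k) (int k - int t) +
        int_binom (int k) (int t - 1) * int_binom (int b - 3 - int k) (int k - int t)) =
      (k choose t) * (compositions u t * (v choose (k - t))) + w t" if "t \<le> k" for t
  proof -
    have 1: "int k - int t = int (k - t)" using that by simp
    have 2: "int_binom (int v - 1) (int (k - t)) = compositions v (Suc (k - t))"
      by (simp add: compositions_def)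
    have 3: "compositions u t * (int_binom (int k) (int t - 1) * compositions v (Suc (k - t))) = w t"
    proof (cases t)
      case 0
      then show ?thesis by (simp add: w_def int_binom_def)
    next
      case (Suc s)
      then have "Suc (k - t) = k - s" "s < k" using that by auto
      then show ?thesis by (simp add: Suc w_def g_def int_binom_nat del: compositions_simps)
    qed
    show ?thesis
      unfolding ab 1 int_binom_nat 2 compositions_def [symmetric] distrib_left 3 by (simp add: mult_ac)
  qed
  have "g k = 0"
  proof (cases "v = 0")
    case True
    then have "u = 0" using assms by (simp add: u_def v_def)
    then show ?thesis by (simp add: g_def)
  qed (simp add: g_def)
  then have "(\<Sum>t\<le>k. g t) = (\<Sum>t<k. g t)" by (simp flip: lessThan_Suc_atMost)
  also have "\<dots> = (\<Sum>t\<le>k. w t)"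
    by (simp add: w_def sum.atMost_shift)
  finally have w: "(\<Sum>t\<le>k. g t) = (\<Sum>t\<le>k. w t)" .
  have "(\<Sum>t = 0..int k.
     int_binom (int a - 3 - int k) (t - 1) *
       (int_binom (int k) t * int_binom (int b - 2 - int k) (int k - t) +
        int_binom (int k) (t - 1) * int_binom (int b - 3 - int k) (int k - t))) =
     (\<Sum>t\<le>k. (k choose t) * (compositions u t * (v choose (k - t))) + w t)"
  proof (rule sum.reindex_cong [of int])
    show "{0..int k} = int ` {..k}" by (simp add: atMost_atLeast0 image_int_atLeastAtMost)
  qed (auto simp: inj_on_def term_eq)
  also have "\<dots> = rook_paths k u v"
    by (simp add: rook_paths_def sum.distrib w [symmetric] distrib_left g_def)
  also have "\<dots> = box_rank k (a - 2) (b - 2)"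
  proof -
    have "k \<le> b - 2" using assms by linarith
    then show ?thesis using assms(3) by (simp add: box_rank_def u_def v_def)
  qed
  finally show ?thesis by (rule sym)
qed

section \<open>The poset of proper divisors\<close>

interpretation pd: refl_antisym pd_le
proof
  show "pd_le x x" for x by (simp add: pd_le_def)
  show "x = y" if "pd_le x y" "pd_le y x" for x y
    using that by (auto simp: pd_le_def prop_div_def prod_eq_iff)
qed

lemma pd_lt_eq: "pd.lt = pd_less"
  by (auto simp: fun_eq_iff pd.lt_def pd_less_def)

definition box :: "nat \<Rightarrow> nat \<Rightarrow> nat \<Rightarrow> nat \<Rightarrow> (nat \<times> nat) set" where
  "box a b p q = {p..<a} \<times> {q..<b}"

lemma comparable_iff:
  "pd.comparable (c, d) (c', d') \<longleftrightarrow> (c, d) = (c', d') \<or>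
     ((c = 0 \<and> c' = 0 \<or> c < c') \<and> (d = 0 \<and> d' = 0 \<or> d < d')) \<or>
     ((c = 0 \<and> c' = 0 \<or> c' < c) \<and> (d = 0 \<and> d' = 0 \<or> d' < d))"
  by (auto simp: pd.comparable_def pd_le_def prop_div_def)

lemma sum_diff_reindex: "(\<Sum>d\<in>{q<..<b}. f (b - Suc d)) = (\<Sum>j<b - Suc q. f j)"
  for f :: "nat \<Rightarrow> nat"
  by (rule sum.reindex_bij_witness [of _ "\<lambda>j. b - Suc j" "\<lambda>d. b - Suc d"]) auto

text \<open>
  The corner \<open>(p,q)\<close> together with the box strictly above it is a cone.  The other points \<open>(p,d)\<close> and
  \<open>(c,q)\<close> on the two edges through the corner are pairwise incomparable and minimal, and the link of
  such a point is the part of the box strictly above it, which the corner cones off.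
\<close>

lemma free_homology_box_step:
  assumes "1 \<le> p" "p < a" "1 \<le> q" "q < b"
    and links: "\<And>p' q'. 1 \<le> p' \<Longrightarrow> 1 \<le> q' \<Longrightarrow> pd.free_homology (box a b p' q') (i - 1) (r (a - p') (b - q'))"
  shows "pd.free_homology (box a b p q) i
    ((\<Sum>j<b - Suc q. r (a - Suc p) j) + (\<Sum>j<a - Suc p. r j (b - Suc q)))"
proof -
  define X where "X = insert (p, q) (box a b (Suc p) (Suc q))"
  define M1 M2 where "M1 = Pair p ` {q<..<b}" and "M2 = (\<lambda>c. (c, q)) ` {p<..<a}"
  define \<rho> where "\<rho> x = r (a - Suc (fst x)) (b - Suc (snd x))" for x
  have link: "pd.link X x = box a b (Suc (fst x)) (Suc (snd x))" if "x \<in> M1 \<union> M2" for x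
    using that assms(1-4)
    by (cases x) (auto simp: X_def M1_def M2_def pd.link_def comparable_iff box_def)
  have "pd.free_homology (X \<union> (M1 \<union> M2)) i (0 + (\<Sum>x\<in>M1 \<union> M2. \<rho> x))"
  proof (rule pd.free_homology_attach [where v = "\<lambda>_. (p, q)"])
    show "finite (M1 \<union> M2)" by (simp add: M1_def M2_def)
    show "(M1 \<union> M2) \<inter> X = {}" by (auto simp: M1_def M2_def X_def box_def)
    show "pd.free_homology X i 0"
      by (rule pd.free_homology_cone [of "(p, q)"]) (auto simp: X_def box_def comparable_iff)
    show "\<not> pd.comparable x y" if "x \<in> M1 \<union> M2" "y \<in> M1 \<union> M2" "x \<noteq> y" for x y
      using that assms(1-4) by (auto simp: M1_def M2_def comparable_iff)
    show "pd.comparable y (p, q)" if "x \<in> M1 \<union> M2" "y \<in> pd.link X x" for x y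
      using that unfolding link [OF that(1)] by (auto simp: M1_def M2_def box_def comparable_iff)
    show "pd.free_homology (pd.link X x) (i - 1) (\<rho> x)" if "x \<in> M1 \<union> M2" for x
      unfolding link [OF that] \<rho>_def by (rule links) auto
  qed (simp add: X_def)
  moreover have "X \<union> (M1 \<union> M2) = box a b p q"
    using assms(1-4) by (auto simp: X_def M1_def M2_def box_def image_iff)
  moreover have "(\<Sum>x\<in>M1 \<union> M2. \<rho> x) = (\<Sum>x\<in>M1. \<rho> x) + (\<Sum>x\<in>M2. \<rho> x)"
    by (rule sum.union_disjoint) (auto simp: M1_def M2_def)
  moreover have "(\<Sum>x\<in>M1. \<rho> x) = (\<Sum>j<b - Suc q. r (a - Suc p) j)"
    unfolding M1_def by (subst sum.reindex) (auto simp: inj_on_def \<rho>_def sum_diff_reindex)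
  moreover have "(\<Sum>x\<in>M2. \<rho> x) = (\<Sum>j<a - Suc p. r j (b - Suc q))"
    unfolding M2_def
    by (subst sum.reindex) (auto simp: inj_on_def \<rho>_def sum_diff_reindex [of "\<lambda>j. r j (b - Suc q)"])
  ultimately show ?thesis by simp
qed

text \<open>
  The degree is shifted so that \<open>k\<close> counts the passages to links needed to reach an empty box, whose
  homology sits in degree \<open>-1\<close>.
\<close>

lemma free_homology_box:
  assumes "1 \<le> p" "1 \<le> q"
  shows "pd.free_homology (box a b p q) (int k - 1) (box_rank k (a - p) (b - q))"
  using assms
proof (induction k arbitrary: p q)
  case 0
  show ?case
  proof (cases "p < a \<and> q < b")
    case True
    have "pd.free_homology (box a b p q) (- 1) ((\<Sum>j<b - Suc q. 0) + (\<Sum>j<a - Suc p. 0))"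
      by (rule free_homology_box_step) (use True 0 pd.free_homology_negative in auto)
    then show ?thesis using True by (simp add: box_rank_0)
  next
    case False
    then have "box a b p q = {}" by (auto simp: box_def)
    then show ?thesis using False pd.free_homology_empty [of "-1"] by (auto simp: box_rank_0)
  qed
next
  case (Suc k)
  show ?case
  proof (cases "p < a \<and> q < b")
    case True
    have "pd.free_homology (box a b p q) (int k)
        ((\<Sum>j<b - Suc q. box_rank k (a - Suc p) j) + (\<Sum>j<a - Suc p. box_rank k j (b - Suc q)))"
      by (rule free_homology_box_step) (use True Suc in auto)
    moreover have "a - p = Suc (a - Suc p)" "b - q = Suc (b - Suc q)" using True by auto
    ultimately show ?thesis by (simp add: box_rank_Suc)
  next
    case False
    then have "box a b p q = {}" by (auto simp: box_def)
    then show ?thesis using False pd.free_homology_empty [of "int k"] by (auto simp: box_rank_def)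
  qed
qed

text \<open>
  The points \<open>(1,0)\<close>, \<open>(0,1)\<close>, \<open>(1,1)\<close> lie below the whole box with corner \<open>(2,2)\<close>, so the first one
  yields a cone \<open>X\<close> over the box and each of the other two a suspension.  All remaining points have
  \<open>(1,0)\<close> or \<open>(0,1)\<close> as a cone point of their link.
\<close>

lemma free_homology_P_poset:
  assumes "2 \<le> a" "2 \<le> b"
  shows "pd.free_homology (P_poset a b - {(0, 0), (a, b)}) (int k) (2 * box_rank k (a - 2) (b - 2))"
proof -
  define X where "X = insert (1, 0) (box a b 2 2)"
  define M :: "(nat \<times> nat) set" where "M = {(0, 1), (1, 1)}"
  define Q where "Q = ({0..<a} \<times> {0..<b}) - {(0, 0)}"
  have link: "pd.link X x = box a b 2 2" if "x \<in> M" for x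
    using that by (auto simp: X_def M_def pd.link_def comparable_iff box_def)
  have "pd.free_homology (X \<union> M) (int k) (0 + (\<Sum>x\<in>M. box_rank k (a - 2) (b - 2)))"
  proof (rule pd.free_homology_attach [where v = "\<lambda>_. (1, 0)"])
    show "pd.free_homology X (int k) 0"
      by (rule pd.free_homology_cone [of "(1, 0)"]) (auto simp: X_def box_def comparable_iff)
    show "pd.comparable y (1, 0)" if "x \<in> M" "y \<in> pd.link X x" for x y
      using that unfolding link [OF that(1)] by (auto simp: box_def comparable_iff)
    show "pd.free_homology (pd.link X x) (int k - 1) (box_rank k (a - 2) (b - 2))" if "x \<in> M" for x
      unfolding link [OF that] by (rule free_homology_box) auto
  qed (auto simp: M_def X_def box_def comparable_iff)
  then have core: "pd.free_homology (X \<union> M) (int k) (2 * box_rank k (a - 2) (b - 2))"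
    by (simp add: M_def mult_2)
  have core_Q: "X \<union> M \<subseteq> Q" using assms by (auto simp: X_def M_def Q_def box_def)
  have rest: "2 \<le> c \<and> d \<le> 1 \<or> c \<le> 1 \<and> 2 \<le> d" if "(c, d) \<in> Q - (X \<union> M)" for c d
    using that by (auto simp: X_def M_def Q_def box_def)
  have "pd.free_homology ((X \<union> M) \<union> (Q - (X \<union> M))) (int k) (2 * box_rank k (a - 2) (b - 2))"
  proof (rule pd.free_homology_beat_points [where v = "\<lambda>x. if snd x \<le> 1 then (1, 0) else (0, 1)", OF _ _ core])
    show "finite (Q - (X \<union> M))" by (simp add: Q_def)
    show "(if snd x \<le> 1 then (1, 0) else (0, 1)) \<in> pd.link (X \<union> M) x" if "x \<in> Q - (X \<union> M)" for x
      using that rest [of "fst x" "snd x"]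
      by (cases x) (auto simp: pd.link_def X_def M_def comparable_iff)
    show "pd.comparable y (if snd x \<le> 1 then (1, 0) else (0, 1))"
      if "x \<in> Q - (X \<union> M)" "y \<in> pd.link (X \<union> M \<union> (Q - (X \<union> M))) x" for x y
    proof -
      have "y \<in> pd.link Q x" using that(2) core_Q by (auto simp: pd.link_def)
      then show ?thesis
        using that(1) rest [of "fst x" "snd x"]
        by (cases x; cases y) (auto simp: pd.link_def comparable_iff Q_def split: if_splits)
    qed
  qed auto
  moreover have "(X \<union> M) \<union> (Q - (X \<union> M)) = Q" using core_Q by auto
  moreover have "P_poset a b - {(0, 0), (a, b)} = Q"
    using assms by (auto simp: P_poset_def pd_le_def prop_div_def Q_def)
  ultimately show ?thesis by simp
qed

theorem theorem1p3:
  fixes a b :: nat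
  assumes "2 \<le> a" and "a \<le> b"
  shows "(\<forall>i::int. i > int a - 2 \<longrightarrow>
            trivial_group (reduced_simplicial_homology pd_less (Delta_P a b) i)) \<and>
         (\<forall>i::int. 0 \<le> i \<and> i \<le> int a - 2 \<longrightarrow>
            abelian_rank (reduced_simplicial_homology pd_less (Delta_P a b) i) =
              enat (2 * (\<Sum>t = 0..i.
                int_binom (int a - 3 - i) (t - 1) *
                  (int_binom i t * int_binom (int b - 2 - i) (i - t) +
                   int_binom i (t - 1) * int_binom (int b - 3 - i) (i - t)))))"
proof -
  have homology_eq: "reduced_simplicial_homology pd_less (Delta_P a b) i =
      pd.homology (P_poset a b - {(0, 0), (a, b)}) i" for i
    by (simp add: Delta_P_def pd_lt_eq)
  have free: "pd.free_homology (P_poset a b - {(0, 0), (a, b)}) (int k) (2 * box_rank k (a - 2) (b - 2))" for k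
    using assms by (intro free_homology_P_poset) auto
  show ?thesis
  proof (intro conjI allI impI)
    fix i :: int assume "i > int a - 2"
    then obtain k where i: "i = int k" and "k > a - 2"
      using assms(1) by (cases i) auto
    then have "box_rank k (a - 2) (b - 2) = 0" by (simp add: box_rank_def)
    then show "trivial_group (reduced_simplicial_homology pd_less (Delta_P a b) i)"
      unfolding homology_eq i using free [of k] by (intro pd.trivial_homology) simp
  next
    fix i :: int assume i_range: "0 \<le> i \<and> i \<le> int a - 2"
    then obtain k where i: "i = int k" and k: "k \<le> a - 2"
      using assms(1) by (cases i) auto
    show "abelian_rank (reduced_simplicial_homology pd_less (Delta_P a b) i) =
        enat (2 * (\<Sum>t = 0..i.
          int_binom (int a - 3 - i) (t - 1) *
            (int_binom i t * int_binom (int b - 2 - i) (i - t) +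
             int_binom i (t - 1) * int_binom (int b - 3 - i) (i - t))))"
      unfolding homology_eq i pd.abelian_rank_homology [OF free]
        box_rank_eq_int_binom [OF assms k] ..
  qed
qed

end
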